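(* Let $\mathcal{G}$ be a condensed group and $\mathcal{X}$ a $\mathcal{G}$-set. Then the $\mathcal{G}$-action on $\mathcal{X}$ is open if and only if the quotient set $\mathcal{G}\backslash\mathcal{X}$ is discrete. In this case, there is an isomorphism of $\mathcal{G}$-sets $$\mathcal{X}\cong\coprod_{x\in(\mathcal{G}\backslash\mathcal{X})( * )}\mathcal{G}x,$$ which decomposes $\mathcal{X}$ into its orbits.
   Context: Set-theoretic issues are ignored. A condensed set/group is a sheaf of sets/groups on the category $\mathbf{CHED}$ of compact Hausdorff extremally disconnected spaces, with finite jointly surjective families as covers; equivalently a contravariant functor $\mathcal{T}$ with $\mathcal{T}(\varnothing)=*$ and $\mathcal{T}(S_1\sqcup S_2)\cong\mathcal{T}(S_1)\times\mathcal{T}(S_2)$. For a ($T1$) topological space $T$, $\underline{T}=C(-,T)$ is the associated condensed set. $\mathcal{T}( * )$ is the underlying set/group. A condensed set $\mathcal{Y}$ is discrete if $\mathcal{Y}=\underline{\mathcal{Y}( * )}$ (canonically), where $\mathcal{Y}( * )$ has the discrete topology. A (left) $\mathcal{G}$-set is a condensed set $\mathcal{X}$ with a natural transformation $\mathcal{G}\times\mathcal{X}\to\mathcal{X}$ making each $\mathcal{X}(S)$ a $\mathcal{G}(S)$-set. The quotient set $\mathcal{G}\backslash\mathcal{X}$ is the condensed set $S\mapsto\mathcal{G}(S)\backslash\mathcal{X}(S)$ (this is a sheaf). For $x\in(\mathcal{G}\backslash\mathcal{X})( * )$, the orbit $\mathcal{G}x\subseteq\mathcal{X}$ is the pullback of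 $\mathcal{X}\to\mathcal{G}\backslash\mathcal{X}$ along $x\colon\underline{*}\to\mathcal{G}\backslash\mathcal{X}$. The $\mathcal{G}$-action on $\mathcal{X}$ is open if for every $S\in\mathbf{CHED}$, every map $\underline{S}\to\mathcal{X}$ and every $x\in(\mathcal{G}\backslash\mathcal{X})( * )$, the condensed set pullback $\underline{S}\times_{\mathcal{X}}\mathcal{G}x$ is representable by an open subset of $S$ (i.e. equals $\underline{P}$ for some open $P\subseteq S$). Coproducts are taken in condensed sets. *)

theory Defs
  imports "HOL-Analysis.Analysis" "HOL-Algebra.Group_Action"
begin

text \<open>
  The type variable \<open>'u\<close> plays the role of the universe: the objects of CHED are the
  extremally disconnected compact Hausdorff spaces whose underlying set is a subset of \<open>'u\<close>.
  Everything is stated for an arbitrary \<open>'u\<close>.  Maps are taken in \<open>extensional\<close> form, so that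
  equality of morphisms is equality of functions and composition is \<open>compose\<close>.
\<close>

definition CHED :: "'u topology set" where
  "CHED = {S. compact_space S \<and> Hausdorff_space S \<and>
              (\<forall>U. openin S U \<longrightarrow> openin S (S closure_of U))}"

definition cmaps :: "'a topology \<Rightarrow> 'b topology \<Rightarrow> ('a \<Rightarrow> 'b) set" where
  "cmaps S T = {f \<in> extensional (topspace S). continuous_map S T f}"

definition incl :: "'a set \<Rightarrow> 'a \<Rightarrow> 'a" where
  "incl U = (\<lambda>s\<in>U. s)"

definition pt :: "'u topology" where
  "pt = discrete_topology {undefined}"

definition point :: "'u \<Rightarrow> 'u \<Rightarrow> 'u" where
  "point s = (\<lambda>_\<in>topspace pt. s)"

definition to_pt :: "'u topology \<Rightarrow> 'u \<Rightarrow> 'u" where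
  "to_pt S = (\<lambda>_\<in>topspace S. undefined)"


section \<open>Condensed sets\<close>

text \<open>For a morphism \<open>f : S \<rightarrow> T\<close>, the restriction map \<open>X(T) \<rightarrow> X(S)\<close> is \<open>res X S T f\<close>.\<close>

record ('u, 'x) cset =
  sec :: "'u topology \<Rightarrow> 'x set"
  res :: "'u topology \<Rightarrow> 'u topology \<Rightarrow> ('u \<Rightarrow> 'u) \<Rightarrow> 'x \<Rightarrow> 'x"

definition ched_presheaf :: "('u, 'x, 'm) cset_scheme \<Rightarrow> bool" where
  "ched_presheaf X \<longleftrightarrow>
     (\<forall>S\<in>CHED. \<forall>T\<in>CHED. \<forall>f\<in>cmaps S T. res X S T f \<in> sec X T \<rightarrow> sec X S) \<and>
     (\<forall>S\<in>CHED. \<forall>x\<in>sec X S. res X S S (incl (topspace S)) x = x) \<and>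
     (\<forall>R\<in>CHED. \<forall>S\<in>CHED. \<forall>T\<in>CHED. \<forall>f\<in>cmaps R S. \<forall>g\<in>cmaps S T. \<forall>x\<in>sec X T.
        res X R T (compose (topspace R) g f) x = res X R S f (res X S T g x))"

text \<open>
  The sheaf condition in the form \<open>X(\<emptyset>) = *\<close> and \<open>X(U \<squnion> V) \<cong> X(U) \<times> X(V)\<close>.  A coproduct
  decomposition of a space \<open>S\<close> is the same as a partition of \<open>S\<close> into two open subsets.
\<close>

definition condensed_set :: "('u, 'x, 'm) cset_scheme \<Rightarrow> bool" where
  "condensed_set X \<longleftrightarrow>
     ched_presheaf X \<and>
     (\<exists>z. sec X (discrete_topology {}) = {z}) \<and>
     (\<forall>S\<in>CHED. \<forall>U V. openin S U \<and> openin S V \<and> U \<inter> V = {} \<and> U \<union> V = topspace S \<longrightarrow>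
        bij_betw (\<lambda>x. (res X (subtopology S U) S (incl U) x, res X (subtopology S V) S (incl V) x))
          (sec X S) (sec X (subtopology S U) \<times> sec X (subtopology S V)))"

definition cset_map ::
  "('u, 'x, 'm) cset_scheme \<Rightarrow> ('u, 'y, 'n) cset_scheme \<Rightarrow> ('u topology \<Rightarrow> 'x \<Rightarrow> 'y) \<Rightarrow> bool" where
  "cset_map X Y \<eta> \<longleftrightarrow>
     (\<forall>S\<in>CHED. \<eta> S \<in> sec X S \<rightarrow> sec Y S) \<and>
     (\<forall>S\<in>CHED. \<forall>T\<in>CHED. \<forall>f\<in>cmaps S T. \<forall>x\<in>sec X T.
        \<eta> S (res X S T f x) = res Y S T f (\<eta> T x))"

definition cset_iso ::
  "('u, 'x, 'm) cset_scheme \<Rightarrow> ('u, 'y, 'n) cset_scheme \<Rightarrow> ('u topology \<Rightarrow> 'x \<Rightarrow> 'y) \<Rightarrow> bool" where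
  "cset_iso X Y \<eta> \<longleftrightarrow> cset_map X Y \<eta> \<and> (\<forall>S\<in>CHED. bij_betw (\<eta> S) (sec X S) (sec Y S))"

definition underline :: "'b topology \<Rightarrow> ('u, 'u \<Rightarrow> 'b) cset" where
  "underline T = \<lparr> sec = (\<lambda>S. cmaps S T), res = (\<lambda>R S f h. compose (topspace R) h f) \<rparr>"

definition cpullback ::
  "('u, 'x, 'm) cset_scheme \<Rightarrow> ('u, 'y, 'n) cset_scheme \<Rightarrow>
   ('u topology \<Rightarrow> 'x \<Rightarrow> 'z) \<Rightarrow> ('u topology \<Rightarrow> 'y \<Rightarrow> 'z) \<Rightarrow> ('u, 'x \<times> 'y) cset" where
  "cpullback X Y p q =
     \<lparr> sec = (\<lambda>S. {(x, y). x \<in> sec X S \<and> y \<in> sec Y S \<and> p S x = q S y}),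
       res = (\<lambda>S T f. map_prod (res X S T f) (res Y S T f)) \<rparr>"

text \<open>
  Evaluating a section \<open>y\<close> over \<open>S\<close> at the points of \<open>S\<close> is the canonical comparison between
  \<open>Y\<close> and the condensed set associated with \<open>Y(*)\<close> (it is inverse to gluing constant sections
  along a locally constant function).
\<close>

definition evaluation ::
  "('u, 'y, 'm) cset_scheme \<Rightarrow> 'u topology \<Rightarrow> 'y \<Rightarrow> 'u \<Rightarrow> 'y" where
  "evaluation Y S y = (\<lambda>s\<in>topspace S. res Y pt S (point s) y)"

definition discrete_cset :: "('u, 'y, 'm) cset_scheme \<Rightarrow> bool" where
  "discrete_cset Y \<longleftrightarrow> cset_iso Y (underline (discrete_topology (sec Y pt))) (evaluation Y)"


section \<open>Condensed groups and their actions\<close>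

record ('u, 'g) cgroup =
  grp :: "'u topology \<Rightarrow> 'g monoid"
  gres :: "'u topology \<Rightarrow> 'u topology \<Rightarrow> ('u \<Rightarrow> 'u) \<Rightarrow> 'g \<Rightarrow> 'g"

definition condensed_group :: "('u, 'g) cgroup \<Rightarrow> bool" where
  "condensed_group G \<longleftrightarrow>
     condensed_set \<lparr> sec = (\<lambda>S. carrier (grp G S)), res = gres G \<rparr> \<and>
     (\<forall>S\<in>CHED. group (grp G S)) \<and>
     (\<forall>S\<in>CHED. \<forall>T\<in>CHED. \<forall>f\<in>cmaps S T. gres G S T f \<in> hom (grp G T) (grp G S))"

record ('u, 'g, 'x) gset = "('u, 'x) cset" +
  act :: "'u topology \<Rightarrow> 'g \<Rightarrow> 'x \<Rightarrow> 'x"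

definition G_set :: "('u, 'g) cgroup \<Rightarrow> ('u, 'g, 'x) gset \<Rightarrow> bool" where
  "G_set G X \<longleftrightarrow>
     condensed_set X \<and>
     (\<forall>S\<in>CHED. group_action (grp G S) (sec X S) (act X S)) \<and>
     (\<forall>S\<in>CHED. \<forall>T\<in>CHED. \<forall>f\<in>cmaps S T. \<forall>g\<in>carrier (grp G T). \<forall>x\<in>sec X T.
        res X S T f (act X T g x) = act X S (gres G S T f g) (res X S T f x))"

definition gset_iso ::
  "('u, 'g) cgroup \<Rightarrow> ('u, 'g, 'x) gset \<Rightarrow> ('u, 'g, 'y) gset \<Rightarrow> ('u topology \<Rightarrow> 'x \<Rightarrow> 'y) \<Rightarrow> bool" where
  "gset_iso G X Y \<eta> \<longleftrightarrow>
     cset_iso X Y \<eta> \<and>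
     (\<forall>S\<in>CHED. \<forall>g\<in>carrier (grp G S). \<forall>x\<in>sec X S. \<eta> S (act X S g x) = act Y S g (\<eta> S x))"

text \<open>
  The restriction of an orbit is the orbit generated by the restriction of any of its elements;
  all members of the union below coincide.
\<close>

definition gquotient :: "('u, 'g) cgroup \<Rightarrow> ('u, 'g, 'x) gset \<Rightarrow> ('u, 'x set) cset" where
  "gquotient G X =
     \<lparr> sec = (\<lambda>S. orbits (grp G S) (sec X S) (act X S)),
       res = (\<lambda>S T f A. \<Union>x\<in>A. orbit (grp G S) (act X S) (res X S T f x)) \<rparr>"

text \<open>
  The pullback of \<open>X \<rightarrow> G\X\<close> along \<open>x : * \<rightarrow> G\X\<close>, as a sub-G-set of \<open>X\<close>: a section
  over \<open>S\<close> is a section of \<open>X\<close> whose class is the pullback of \<open>x\<close> along \<open>S \<rightarrow> *\<close>.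
\<close>

definition gorbit ::
  "('u, 'g) cgroup \<Rightarrow> ('u, 'g, 'x) gset \<Rightarrow> 'x set \<Rightarrow> ('u, 'g, 'x) gset" where
  "gorbit G X x =
     (let Z = (\<lambda>S. {y \<in> sec X S.
                 orbit (grp G S) (act X S) y = res (gquotient G X) S pt (to_pt S) x})
      in \<lparr> sec = Z, res = res X, act = (\<lambda>S g. restrict (act X S g) (Z S)) \<rparr>)"

definition open_action :: "('u, 'g) cgroup \<Rightarrow> ('u, 'g, 'x) gset \<Rightarrow> bool" where
  "open_action G X \<longleftrightarrow>
     (\<forall>S\<in>(CHED :: 'u topology set). \<forall>\<eta>. cset_map (underline S) X \<eta> \<longrightarrow>
        (\<forall>x\<in>sec (gquotient G X) pt.
           \<exists>P. openin S P \<and>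
               cset_iso (cpullback (underline S) (gorbit G X x) \<eta> (\<lambda>_ y. y))
                 (underline (subtopology S P)) (\<lambda>_. fst)))"


section \<open>Coproducts\<close>

definition fiber :: "'u topology \<Rightarrow> ('u \<Rightarrow> 'i) \<Rightarrow> 'i \<Rightarrow> 'u topology" where
  "fiber S \<phi> i = subtopology S {s \<in> topspace S. \<phi> s = i}"

text \<open>
  The coproduct in condensed sets is the sheafification of the disjoint union of presheaves.  A
  section over \<open>S\<close> is therefore a locally constant function \<open>\<phi> : S \<rightarrow> I\<close> (equivalently, a
  finite partition of \<open>S\<close> into open subsets labelled by elements of \<open>I\<close>) together with a section
  of the summand \<open>X i\<close> over the fibre of \<open>\<phi>\<close> over \<open>i\<close>, for each value \<open>i\<close> of \<open>\<phi>\<close>.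
  The group acts summand by summand.
\<close>

definition gcoproduct ::
  "('u, 'g) cgroup \<Rightarrow> 'i set \<Rightarrow> ('i \<Rightarrow> ('u, 'g, 'x) gset) \<Rightarrow>
   ('u, 'g, ('u \<Rightarrow> 'i) \<times> ('i \<Rightarrow> 'x)) gset" where
  "gcoproduct G I X =
     (let Z = (\<lambda>S. SIGMA \<phi>:cmaps S (discrete_topology I).
                      \<Pi>\<^sub>E i\<in>\<phi> ` topspace S. sec (X i) (fiber S \<phi> i))
      in \<lparr> sec = Z,
           res = (\<lambda>S T f (\<phi>, \<xi>). let \<psi> = compose (topspace S) \<phi> f in
              (\<psi>, \<lambda>i\<in>\<psi> ` topspace S.
                    res (X i) (fiber S \<psi> i) (fiber T \<phi> i)
                      (restrict f (topspace (fiber S \<psi> i))) (\<xi> i))),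
           act = (\<lambda>S g. restrict (\<lambda>(\<phi>, \<xi>).
              (\<phi>, \<lambda>i\<in>\<phi> ` topspace S.
                    act (X i) (fiber S \<phi> i)
                      (gres G (fiber S \<phi> i) S (incl (topspace (fiber S \<phi> i))) g) (\<xi> i)))
              (Z S)) \<rparr>)"

definition coprojection :: "'i \<Rightarrow> 'u topology \<Rightarrow> 'x \<Rightarrow> ('u \<Rightarrow> 'i) \<times> ('i \<Rightarrow> 'x)" where
  "coprojection i S y =
     (let \<phi> = (\<lambda>_\<in>topspace S. i) in (\<phi>, \<lambda>_\<in>\<phi> ` topspace S. y))"

end

theory Submission
  imports Defs
begin

text \<open>
  Write \<open>Y\<close> for the quotient.  By Yoneda a map from the condensed set of \<open>S\<close> to \<open>X\<close> is a section
  \<open>y\<close> of \<open>X\<close> over \<open>S\<close>, and it gives each point of \<open>S\<close> a \<^emph>\<open>label\<close>: the orbit, an element of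
  \<open>Y(*)\<close>, of the value of \<open>y\<close> at this point.  The label function depends only on the class of \<open>y\<close>;
  it is the evaluation of that class.

  If \<open>S \<times>\<^sub>X Gi\<close> is represented by \<open>P \<subseteq> S\<close>, testing on points shows that \<open>P\<close> is the set of points
  with label \<open>i\<close>.  So openness says two things: the fibres of the label function are open, that is,
  labels are locally constant; and on the fibre over \<open>i\<close> the section \<open>y\<close> lies in \<open>Gi\<close> as a section
  and not merely pointwise.  Since \<open>S\<close> is compact, a locally constant function has finitely many
  fibres, all clopen, and the sheaf property glues over them.  As \<open>Y\<close> is again a sheaf (lemma
  \<open>quotient_condensed\<close>), the two properties say that a class is determined by its label function
  (on each fibre it is the constant class) and that every locally constant function to \<open>Y(*)\<close> is
  a label function (glue constants): this is discreteness, see \<open>discrete_csetI\<close>.  Conversely, if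
  \<open>Y\<close> is discrete, then a class is constant as soon as its labels are, so that the set of points
  with label \<open>i\<close>, which is open, represents the pullback.

  For the decomposition, a section \<open>y\<close> is cut into its restrictions to the fibres of its label
  function.  The label function and these restrictions are by construction a section of the
  coproduct of the orbits, and gluing inverts the construction.
\<close>


section \<open>Clopen pieces of extremally disconnected spaces\<close>

definition clopenin :: "'a topology \<Rightarrow> 'a set \<Rightarrow> bool" where
  "clopenin S U \<longleftrightarrow> openin S U \<and> closedin S U"

lemma clopenin_subset: "clopenin S U \<Longrightarrow> U \<subseteq> topspace S"
  by (simp add: clopenin_def openin_subset)

lemma topspace_clopen: "clopenin S U \<Longrightarrow> topspace (subtopology S U) = U"
  by (simp add: clopenin_subset inf.absorb2)

lemma clopenin_disjoint_pieces:
  assumes "openin S U" "openin S V" "U \<inter> V = {}" "U \<union> V = topspace S"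
  shows "clopenin S U" "clopenin S V"
proof -
  have "topspace S - V = U" "topspace S - U = V" using assms by auto
  with assms show "clopenin S U" "clopenin S V"
    by (metis clopenin_def closedin_def openin_subset)+
qed

text \<open>
  Closedness in \<open>S\<close> gives compactness of the piece; openness makes open sets of the piece, and
  their closures in it, open in \<open>S\<close>.
\<close>

lemma clopen_in_CHED:
  assumes "S \<in> CHED" "clopenin S U"
  shows "subtopology S U \<in> CHED"
proof -
  have "compact_space (subtopology S U)"
    using assms by (auto simp: CHED_def clopenin_def
        intro: compact_space_subtopology closedin_compact_space)
  moreover have "openin (subtopology S U) (subtopology S U closure_of W)"
    if W: "openin (subtopology S U) W" for W
  proof -
    have "openin S W" "W \<subseteq> U"
      using W assms by (auto simp: clopenin_def openin_open_subtopology)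
    then have "openin S (U \<inter> S closure_of W)"
      using assms by (auto simp: CHED_def clopenin_def)
    with \<open>W \<subseteq> U\<close> show ?thesis
      using assms by (simp add: closure_of_subtopology openin_open_subtopology clopenin_def
          inf.absorb2)
  qed
  ultimately show ?thesis
    using assms by (simp add: CHED_def Hausdorff_space_subtopology)
qed

lemma pt_in_CHED: "pt \<in> CHED"
  by (auto simp: CHED_def pt_def compact_space_discrete_topology dest: in_closure_of[THEN iffD1])

lemma incl_in_cmaps: "clopenin S U \<Longrightarrow> incl U \<in> cmaps (subtopology S U) S"
  by (auto simp: cmaps_def incl_def topspace_clopen inf.absorb2[OF clopenin_subset]
      intro!: continuous_map_from_subtopology continuous_map_eq[OF continuous_map_id])

lemma id_in_cmaps: "incl (topspace S) \<in> cmaps S S"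
  by (auto simp: cmaps_def incl_def intro!: continuous_map_eq[OF continuous_map_id])

lemma point_in_cmaps: "s \<in> topspace S \<Longrightarrow> point s \<in> cmaps pt S"
  by (auto simp: cmaps_def point_def intro!: continuous_map_eq[OF continuous_map_const[THEN iffD2]])

lemma to_pt_in_cmaps: "to_pt S \<in> cmaps S pt"
  by (auto simp: cmaps_def to_pt_def pt_def
      intro!: continuous_map_eq[OF continuous_map_const[THEN iffD2]])

lemma compose_in_cmaps:
  assumes "f \<in> cmaps R S" "g \<in> cmaps S T"
  shows "compose (topspace R) g f \<in> cmaps R T"
  using assms
  by (auto simp: cmaps_def compose_def intro: continuous_map_eq[OF continuous_map_compose[of R S f T g]])

lemma cmaps_mem: "f \<in> cmaps S T \<Longrightarrow> s \<in> topspace S \<Longrightarrow> f s \<in> topspace T"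
  by (auto simp: cmaps_def dest: continuous_map_funspace)

lemma cmaps_extensional: "f \<in> cmaps S T \<Longrightarrow> f \<in> extensional (topspace S)"
  by (simp add: cmaps_def)

lemma cmaps_subtopology:
  "f \<in> cmaps R (subtopology S P) \<longleftrightarrow> f \<in> cmaps R S \<and> f ` topspace R \<subseteq> P"
  by (auto simp: cmaps_def continuous_map_in_subtopology)

lemma cmaps_discrete_iff:
  "\<phi> \<in> cmaps S (discrete_topology I) \<longleftrightarrow>
     \<phi> \<in> extensional (topspace S) \<and> \<phi> ` topspace S \<subseteq> I \<and>
     (\<forall>i\<in>I. openin S {s \<in> topspace S. \<phi> s = i})"  (is "?L \<longleftrightarrow> ?R")
proof
  assume ?L
  then have "continuous_map S (discrete_topology I) \<phi>" "\<phi> \<in> extensional (topspace S)"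
    by (auto simp: cmaps_def)
  then show ?R
    using openin_continuous_map_preimage[of S "discrete_topology I" \<phi> "{_}"]
    by (fastforce dest: continuous_map_funspace)
next
  assume R: ?R
  have "openin S {s \<in> topspace S. \<phi> s \<in> U}" if "U \<subseteq> I" for U
  proof -
    have "{s \<in> topspace S. \<phi> s \<in> U} = (\<Union>i\<in>U. {s \<in> topspace S. \<phi> s = i})" by auto
    also have "openin S \<dots>" using R that by blast
    finally show ?thesis .
  qed
  then show ?L using R by (auto simp: cmaps_def continuous_map_def)
qed

lemma clopenin_fibre:
  assumes "\<phi> \<in> cmaps S (discrete_topology I)"
  shows "clopenin S {s \<in> topspace S. \<phi> s = i}"
proof (cases "i \<in> I")
  case True
  then show ?thesis
    using assms openin_continuous_map_preimage[of S "discrete_topology I" \<phi> "{i}"]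
      closedin_continuous_map_preimage[of S "discrete_topology I" \<phi> "{i}"]
    by (auto simp: clopenin_def cmaps_def)
next
  case False
  then have "{s \<in> topspace S. \<phi> s = i} = {}"
    using cmaps_mem[OF assms] by auto
  then show ?thesis by (simp only:) (simp add: clopenin_def)
qed

lemma topspace_fiber: "topspace (fiber S \<phi> i) = {s \<in> topspace S. \<phi> s = i}"
  by (auto simp: fiber_def)

lemma fiber_in_CHED:
  "S \<in> CHED \<Longrightarrow> \<phi> \<in> cmaps S (discrete_topology I) \<Longrightarrow> fiber S \<phi> i \<in> CHED"
  unfolding fiber_def by (rule clopen_in_CHED) (auto intro: clopenin_fibre)

lemma incl_fiber_in_cmaps:
  "\<phi> \<in> cmaps S (discrete_topology I) \<Longrightarrow>
   incl {s \<in> topspace S. \<phi> s = i} \<in> cmaps (fiber S \<phi> i) S"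
  unfolding fiber_def by (intro incl_in_cmaps clopenin_fibre)

text \<open>
  Compactness enters here: it makes the partition of a space into the fibres of a locally constant
  function finite, so that the sheaf condition for finite covers applies to it.
\<close>

lemma finite_image_discrete:
  assumes "S \<in> CHED" "\<phi> \<in> cmaps S (discrete_topology I)"
  shows "finite (\<phi> ` topspace S)"
proof -
  have "compactin (discrete_topology I) (\<phi> ` topspace S)"
    using assms by (auto simp: CHED_def cmaps_def compact_space_def intro: image_compactin)
  then show ?thesis by (simp add: compactin_discrete_topology)
qed


section \<open>Restriction and gluing of sections\<close>

lemma res_in_sec:
  assumes "ched_presheaf X" "S \<in> CHED" "T \<in> CHED" "f \<in> cmaps S T" "x \<in> sec X T"
  shows "res X S T f x \<in> sec X S"
  using assms by (auto simp: ched_presheaf_def)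

lemma res_id:
  "ched_presheaf X \<Longrightarrow> S \<in> CHED \<Longrightarrow> x \<in> sec X S \<Longrightarrow> res X S S (incl (topspace S)) x = x"
  by (simp add: ched_presheaf_def)

lemma res_res:
  assumes "ched_presheaf X" "R \<in> CHED" "S \<in> CHED" "T \<in> CHED" "f \<in> cmaps R S" "g \<in> cmaps S T"
    "x \<in> sec X T"
  shows "res X R S f (res X S T g x) = res X R T (compose (topspace R) g f) x"
  using assms by (auto simp: ched_presheaf_def)

lemma condensed_presheaf: "condensed_set X \<Longrightarrow> ched_presheaf X"
  by (simp add: condensed_set_def)

abbreviation restr :: "('u, 'x, 'm) cset_scheme \<Rightarrow> 'u topology \<Rightarrow> 'u set \<Rightarrow> 'x \<Rightarrow> 'x" where
  "restr X S U \<equiv> res X (subtopology S U) S (incl U)"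

lemma restr_in_sec:
  assumes "ched_presheaf X" "S \<in> CHED" "clopenin S U" "x \<in> sec X S"
  shows "restr X S U x \<in> sec X (subtopology S U)"
  using assms by (intro res_in_sec clopen_in_CHED incl_in_cmaps) auto

lemma restr_restr:
  assumes "ched_presheaf X" "S \<in> CHED" "clopenin S U" "clopenin S W" "W \<subseteq> U" "x \<in> sec X S"
  shows "restr X (subtopology S U) W (restr X S U x) = restr X S W x"
proof -
  have sub: "subtopology (subtopology S U) W = subtopology S W"
    using assms by (simp add: subtopology_subtopology inf.absorb2)
  have "clopenin (subtopology S U) W"
    using assms by (auto simp: clopenin_def openin_open_subtopology closedin_closed_subtopology)
  then have "incl W \<in> cmaps (subtopology S W) (subtopology S U)"
    using incl_in_cmaps sub by metis
  moreover have "compose W (incl U) (incl W) = incl W"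
    using assms(5) by (auto simp: compose_def incl_def fun_eq_iff)
  ultimately show ?thesis
    using assms by (simp add: sub res_res clopen_in_CHED incl_in_cmaps topspace_clopen
        clopenin_subset inf.absorb2)
qed

text \<open>Yoneda: a map out of a representable is determined by the image of the identity.\<close>

lemma cset_map_from_representable:
  assumes "cset_map (underline S) X \<eta>" "S \<in> CHED" "R \<in> CHED" "f \<in> cmaps R S"
  shows "\<eta> R f = res X R S f (\<eta> S (incl (topspace S)))"
proof -
  have "\<eta> R (res (underline S) R S f (incl (topspace S))) = res X R S f (\<eta> S (incl (topspace S)))"
    using assms id_in_cmaps[of S] by (auto simp: cset_map_def underline_def)
  moreover have "res (underline S) R S f (incl (topspace S)) = f"
    using cmaps_mem[OF assms(4)] cmaps_extensional[OF assms(4)]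
    by (auto simp: underline_def compose_def incl_def extensional_def fun_eq_iff)
  ultimately show ?thesis by simp
qed

text \<open>
  The bijection in the sheaf condition as a statement of unique existence, the form that is stable
  under induction on the number of pieces.
\<close>

lemma binary_gluing:
  assumes "condensed_set X" "S \<in> CHED" "openin S U" "openin S V" "U \<inter> V = {}"
    "U \<union> V = topspace S" "a \<in> sec X (subtopology S U)" "b \<in> sec X (subtopology S V)"
  shows "\<exists>!x. x \<in> sec X S \<and> restr X S U x = a \<and> restr X S V x = b"
proof -
  have bij: "bij_betw (\<lambda>x. (restr X S U x, restr X S V x))
      (sec X S) (sec X (subtopology S U) \<times> sec X (subtopology S V))"
    using assms(1-6) unfolding condensed_set_def by blast
  show ?thesis
    using bij_betwE assms(7,8) bij_betw_imp_surj_on[OF bij] inj_onD[OF bij_betw_imp_inj_on[OF bij]]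
    by (smt (verit) imageE mem_Sigma_iff prod.inject)
qed

text \<open>
  Induction on the number of pieces: the first piece and the union of the others form a binary
  partition.  An empty family covers only the empty space, where the sheaf condition gives exactly
  one section.
\<close>

lemma finite_gluing:
  assumes "condensed_set X" "finite J" "S \<in> CHED" "\<And>j. j \<in> J \<Longrightarrow> openin S (W j)"
    "disjoint_family_on W J" "(\<Union>j\<in>J. W j) = topspace S"
    "\<And>j. j \<in> J \<Longrightarrow> \<xi> j \<in> sec X (subtopology S (W j))"
  shows "\<exists>!x. x \<in> sec X S \<and> (\<forall>j\<in>J. restr X S (W j) x = \<xi> j)"
  using assms(2-7)
proof (induction J arbitrary: S)
  case empty
  then have "S = discrete_topology {}" by (metis UN_empty null_topspace_iff_trivial)
  then show ?case using assms(1) unfolding condensed_set_def by auto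
next
  case (insert k J)
  define V where "V = (\<Union>j\<in>J. W j)"
  have U: "openin S (W k)" and V: "openin S V"
    using insert.prems(2) by (auto simp: V_def)
  have disj: "W k \<inter> V = {}"
    using insert.prems(3) insert.hyps(2) by (auto simp: disjoint_family_on_def V_def)
  have un: "W k \<union> V = topspace S" using insert.prems(4) by (auto simp: V_def)
  have clV: "clopenin S V" using clopenin_disjoint_pieces(2)[OF U V disj un] .
  have WV: "W j \<subseteq> V" if "j \<in> J" for j using that by (auto simp: V_def)
  have sub: "subtopology (subtopology S V) (W j) = subtopology S (W j)" if "j \<in> J" for j
    using WV[OF that] by (simp add: subtopology_subtopology inf.absorb2)
  have "\<exists>!x. x \<in> sec X (subtopology S V) \<and>
      (\<forall>j\<in>J. restr X (subtopology S V) (W j) x = \<xi> j)"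
  proof (rule insert.IH)
    show "subtopology S V \<in> CHED" using insert.prems(1) clV by (rule clopen_in_CHED)
    show "openin (subtopology S V) (W j)" if "j \<in> J" for j
      using that insert.prems(2) WV V by (auto simp: openin_open_subtopology)
    show "disjoint_family_on W J" using insert.prems(3) by (auto simp: disjoint_family_on_def)
    show "(\<Union>j\<in>J. W j) = topspace (subtopology S V)"
      using topspace_clopen[OF clV] by (simp add: V_def)
    show "\<xi> j \<in> sec X (subtopology (subtopology S V) (W j))" if "j \<in> J" for j
      using insert.prems(5)[of j] that sub by simp
  qed
  then obtain v where v: "v \<in> sec X (subtopology S V)"
      "\<forall>j\<in>J. restr X (subtopology S V) (W j) v = \<xi> j"
    and v_unique: "\<And>v'. v' \<in> sec X (subtopology S V) \<Longrightarrow>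
      \<forall>j\<in>J. restr X (subtopology S V) (W j) v' = \<xi> j \<Longrightarrow> v' = v"
    by blast
  \<comment> \<open>The complement of a piece is the union of the other pieces, hence open.\<close>
  have clW: "clopenin S (W j)" if "j \<in> J" for j
  proof -
    have "(W j) \<inter> (topspace S - W j) = {}" by blast
    moreover have "topspace S - W j = W k \<union> (\<Union>i\<in>J-{j}. W i)"
      using insert.prems(3,4) insert.hyps(2) that unfolding disjoint_family_on_def by fastforce
    moreover have "openin S (W k \<union> (\<Union>i\<in>J-{j}. W i))"
      using insert.prems(2) by (intro openin_Un openin_Union) auto
    ultimately show ?thesis
      using insert.prems(2)[of j] that openin_subset[of S "W j"]
      by (auto simp: clopenin_def closedin_def)
  qed
  have rr: "restr X (subtopology S V) (W j) (restr X S V x) = restr X S (W j) x"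
    if "j \<in> J" "x \<in> sec X S" for j x
    using restr_restr[OF condensed_presheaf[OF assms(1)] insert.prems(1) clV clW WV] that by blast
  have rV: "restr X S V x \<in> sec X (subtopology S V)" if "x \<in> sec X S" for x
    using restr_in_sec[OF condensed_presheaf[OF assms(1)] insert.prems(1) clV that] .
  have eq: "(restr X S (W k) x = \<xi> k \<and> restr X S V x = v) \<longleftrightarrow>
      (\<forall>j\<in>insert k J. restr X S (W j) x = \<xi> j)" if "x \<in> sec X S" for x
    using v v_unique[OF rV[OF that]] rr[OF _ that] by auto
  have ex1: "\<exists>!x. x \<in> sec X S \<and> restr X S (W k) x = \<xi> k \<and> restr X S V x = v"
    using binary_gluing[OF assms(1) insert.prems(1) U V disj un] insert.prems(5)[of k] v(1)
    by blast
  have "x \<in> sec X S \<and> restr X S (W k) x = \<xi> k \<and> restr X S V x = v \<longleftrightarrow>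
      x \<in> sec X S \<and> (\<forall>j\<in>insert k J. restr X S (W j) x = \<xi> j)" for x
    using eq[of x] by blast
  with ex1 show ?case by simp
qed

lemma fibre_gluing:
  assumes "condensed_set X" "S \<in> CHED" "\<phi> \<in> cmaps S (discrete_topology I)"
    "\<And>i. i \<in> \<phi> ` topspace S \<Longrightarrow> \<xi> i \<in> sec X (fiber S \<phi> i)"
  shows "\<exists>!x. x \<in> sec X S \<and>
    (\<forall>i\<in>\<phi> ` topspace S. res X (fiber S \<phi> i) S (incl (topspace (fiber S \<phi> i))) x = \<xi> i)"
  unfolding topspace_fiber unfolding fiber_def
proof (rule finite_gluing)
  show "finite (\<phi> ` topspace S)" using assms(2,3) by (rule finite_image_discrete)
  show "openin S {s \<in> topspace S. \<phi> s = i}" for i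
    using clopenin_fibre[OF assms(3)] by (simp add: clopenin_def)
qed (use assms in \<open>auto simp: disjoint_family_on_def fiber_def\<close>)

lemma fibre_separation:
  assumes X: "condensed_set X" and S: "S \<in> CHED" and \<phi>: "\<phi> \<in> cmaps S (discrete_topology I)"
    and x: "x \<in> sec X S" and y: "y \<in> sec X S"
    and eq: "\<And>i. i \<in> \<phi> ` topspace S \<Longrightarrow>
      res X (fiber S \<phi> i) S (incl (topspace (fiber S \<phi> i))) x =
      res X (fiber S \<phi> i) S (incl (topspace (fiber S \<phi> i))) y"
  shows "x = y"
proof -
  let ?r = "\<lambda>i. res X (fiber S \<phi> i) S (incl (topspace (fiber S \<phi> i)))"
  have "\<exists>!z. z \<in> sec X S \<and> (\<forall>i\<in>\<phi> ` topspace S. ?r i z = ?r i y)"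
    using incl_fiber_in_cmaps[OF \<phi>]
    by (intro fibre_gluing[OF X S \<phi>] res_in_sec[OF condensed_presheaf[OF X]] fiber_in_CHED[OF S \<phi>]
        S y) (simp add: topspace_fiber)
  then have "\<exists>\<^sub>\<le>\<^sub>1z. z \<in> sec X S \<and> (\<forall>i\<in>\<phi> ` topspace S. ?r i z = ?r i y)"
    by (simp only: ex1_iff_ex_Uniq)
  then show ?thesis
    by (rule Uniq_D) (use x y eq in auto)
qed


section \<open>A criterion for discreteness\<close>

lemma evaluation_natural:
  assumes "ched_presheaf Y" "S \<in> CHED" "T \<in> CHED" "f \<in> cmaps S T" "y \<in> sec Y T"
  shows "evaluation Y S (res Y S T f y) = compose (topspace S) (evaluation Y T y) f"
proof
  fix s
  have "compose (topspace pt) f (point s) = point (f s)"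
    by (auto simp: compose_def point_def)
  then show "evaluation Y S (res Y S T f y) s = compose (topspace S) (evaluation Y T y) f s"
    using assms cmaps_mem[OF assms(4)]
    by (auto simp: evaluation_def compose_def res_res point_in_cmaps pt_in_CHED)
qed

lemma evaluation_constant:
  assumes "ched_presheaf Y" "S \<in> CHED" "i \<in> sec Y pt"
  shows "evaluation Y S (res Y S pt (to_pt S) i) = (\<lambda>_\<in>topspace S. i)"
proof -
  have "compose (topspace pt) (to_pt S) (point s) = incl (topspace pt)" if "s \<in> topspace S" for s
    using that by (auto simp: compose_def point_def to_pt_def incl_def pt_def)
  then show ?thesis
    using assms by (auto simp: evaluation_def res_res point_in_cmaps to_pt_in_cmaps pt_in_CHED res_id)
qed

lemma evaluation_restriction:
  assumes "ched_presheaf Y" "S \<in> CHED" "\<phi> \<in> cmaps S (discrete_topology I)" "y \<in> sec Y S"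
    "s \<in> topspace S"
  shows "evaluation Y S y s =
    evaluation Y (fiber S \<phi> (\<phi> s))
      (res Y (fiber S \<phi> (\<phi> s)) S (incl (topspace (fiber S \<phi> (\<phi> s)))) y) s"
proof -
  have "evaluation Y (fiber S \<phi> (\<phi> s))
      (res Y (fiber S \<phi> (\<phi> s)) S (incl (topspace (fiber S \<phi> (\<phi> s)))) y) =
    compose (topspace (fiber S \<phi> (\<phi> s))) (evaluation Y S y)
      (incl (topspace (fiber S \<phi> (\<phi> s))))"
    using assms
    by (intro evaluation_natural) (auto simp: topspace_fiber fiber_in_CHED incl_fiber_in_cmaps)
  then show ?thesis using assms(5) by (simp add: topspace_fiber compose_def incl_def)
qed

text \<open>
  Both halves of the bijection come from gluing over the fibres of a locally constant function:
  a section is recovered from its evaluation as the gluing of constants, and conversely constants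
  on the fibres of any locally constant function glue to a section that evaluates to it.
\<close>

lemma discrete_csetI:
  assumes Y: "condensed_set Y"
    and loc_const: "\<And>S y. S \<in> CHED \<Longrightarrow> y \<in> sec Y S \<Longrightarrow>
      evaluation Y S y \<in> cmaps S (discrete_topology (sec Y pt))"
    and const_on_fibres: "\<And>S y i. S \<in> CHED \<Longrightarrow> y \<in> sec Y S \<Longrightarrow> i \<in> evaluation Y S y ` topspace S \<Longrightarrow>
      res Y (fiber S (evaluation Y S y) i) S (incl (topspace (fiber S (evaluation Y S y) i))) y =
      res Y (fiber S (evaluation Y S y) i) pt (to_pt (fiber S (evaluation Y S y) i)) i"
  shows "discrete_cset Y"
proof -
  note pre = condensed_presheaf[OF Y]
  have fib_sec: "res Y (fiber S \<phi> i) pt (to_pt (fiber S \<phi> i)) i \<in> sec Y (fiber S \<phi> i)"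
    if "S \<in> CHED" "\<phi> \<in> cmaps S (discrete_topology (sec Y pt))" "i \<in> \<phi> ` topspace S" for S \<phi> i
    using that cmaps_mem[OF that(2)] pre
    by (auto intro!: res_in_sec fiber_in_CHED pt_in_CHED to_pt_in_cmaps)
  have "bij_betw (evaluation Y S) (sec Y S) (cmaps S (discrete_topology (sec Y pt)))"
    if S: "S \<in> CHED" for S
  proof (rule bij_betw_imageI)
    show "inj_on (evaluation Y S) (sec Y S)"
    proof (rule inj_onI)
      fix y z assume y: "y \<in> sec Y S" and z: "z \<in> sec Y S"
        and eq: "evaluation Y S y = evaluation Y S z"
      show "y = z"
        using fibre_separation[OF Y S loc_const[OF S y] y z]
          const_on_fibres[OF S y] const_on_fibres[OF S z, folded eq] by simp
    qed
    show "evaluation Y S ` sec Y S = cmaps S (discrete_topology (sec Y pt))"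
    proof (intro subset_antisym subsetI)
      fix \<phi> assume \<phi>: "\<phi> \<in> cmaps S (discrete_topology (sec Y pt))"
      obtain y where y: "y \<in> sec Y S" and yi: "\<And>i. i \<in> \<phi> ` topspace S \<Longrightarrow>
          res Y (fiber S \<phi> i) S (incl (topspace (fiber S \<phi> i))) y =
          res Y (fiber S \<phi> i) pt (to_pt (fiber S \<phi> i)) i"
        using fibre_gluing[OF Y S \<phi>, OF fib_sec[OF S \<phi>]] by blast
      have "evaluation Y S y s = \<phi> s" if s: "s \<in> topspace S" for s
        using evaluation_restriction[OF pre S \<phi> y s] yi[of "\<phi> s"] s cmaps_mem[OF \<phi> s]
        by (simp add: evaluation_constant[OF pre fiber_in_CHED[OF S \<phi>]] topspace_fiber)
      then have "evaluation Y S y = \<phi>"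
        using cmaps_extensional[OF \<phi>] by (auto simp: evaluation_def extensional_def fun_eq_iff)
      with y show "\<phi> \<in> evaluation Y S ` sec Y S" by blast
    qed (use loc_const[OF S] in auto)
  qed
  then show ?thesis
    using evaluation_natural[OF pre] loc_const
    by (auto simp: discrete_cset_def cset_iso_def cset_map_def underline_def)
qed

lemma discrete_csetD:
  assumes "discrete_cset Y" "S \<in> CHED"
  shows "y \<in> sec Y S \<Longrightarrow> evaluation Y S y \<in> cmaps S (discrete_topology (sec Y pt))"
    and "inj_on (evaluation Y S) (sec Y S)"
  using assms
  by (auto simp: discrete_cset_def cset_iso_def bij_betw_def underline_def cset_map_def)

text \<open>
  Membership of a section in the orbit of \<open>i\<close> is an equation of this kind, and discreteness turns
  it into a pointwise condition.
\<close>

lemma discrete_eq_constant_iff: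
  assumes "discrete_cset Y" "ched_presheaf Y" "S \<in> CHED" "y \<in> sec Y S" "i \<in> sec Y pt"
  shows "y = res Y S pt (to_pt S) i \<longleftrightarrow> (\<forall>s\<in>topspace S. evaluation Y S y s = i)"
proof
  assume "\<forall>s\<in>topspace S. evaluation Y S y s = i"
  then have "evaluation Y S y = evaluation Y S (res Y S pt (to_pt S) i)"
    by (subst evaluation_constant[OF assms(2,3,5)]) (auto simp: evaluation_def fun_eq_iff)
  then show "y = res Y S pt (to_pt S) i"
    using discrete_csetD(2)[OF assms(1,3)] assms
    by (auto dest!: inj_onD intro!: res_in_sec pt_in_CHED to_pt_in_cmaps)
qed (use assms evaluation_constant[of Y S i] in auto)


section \<open>The quotient of a condensed set by a condensed group\<close>

locale condensed_action =
  fixes G :: "('u, 'g) cgroup" and X :: "('u, 'g, 'x) gset"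
  assumes G: "condensed_group G" and X: "G_set G X"
begin

abbreviation Y :: "('u, 'x set) cset" where
  "Y \<equiv> gquotient G X"

abbreviation cls :: "'u topology \<Rightarrow> 'x \<Rightarrow> 'x set" where
  "cls S y \<equiv> orbit (grp G S) (act X S) y"

lemma X_condensed: "condensed_set X"
  and X_presheaf: "ched_presheaf X"
  using X by (simp_all add: G_set_def condensed_set_def)

lemma G_condensed: "condensed_set \<lparr>sec = \<lambda>S. carrier (grp G S), res = gres G\<rparr>"
  using G by (simp add: condensed_group_def)

lemma gres_carrier:
  assumes "S \<in> CHED" "T \<in> CHED" "f \<in> cmaps S T" "g \<in> carrier (grp G T)"
  shows "gres G S T f g \<in> carrier (grp G S)"
  using res_in_sec[OF condensed_presheaf[OF G_condensed] assms(1-3)] assms(4) by simp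

lemma is_action: "S \<in> CHED \<Longrightarrow> group_action (grp G S) (sec X S) (act X S)"
  using X by (simp add: G_set_def)

lemma act_in_sec:
  "S \<in> CHED \<Longrightarrow> g \<in> carrier (grp G S) \<Longrightarrow> y \<in> sec X S \<Longrightarrow> act X S g y \<in> sec X S"
  using group_action.element_image[OF is_action] by blast

lemma res_act:
  assumes "S \<in> CHED" "T \<in> CHED" "f \<in> cmaps S T" "g \<in> carrier (grp G T)" "y \<in> sec X T"
  shows "res X S T f (act X T g y) = act X S (gres G S T f g) (res X S T f y)"
  using X assms by (auto simp: G_set_def)

lemma cls_eq_iff:
  assumes "S \<in> CHED" "y \<in> sec X S" "z \<in> sec X S"
  shows "cls S y = cls S z \<longleftrightarrow> (\<exists>g\<in>carrier (grp G S). act X S g y = z)"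
proof -
  interpret group_action "grp G S" "sec X S" "act X S" using is_action[OF assms(1)] .
  have "cls S y = cls S z \<longleftrightarrow> z \<in> cls S y"
    using disjoint_union[of "cls S y" "cls S z"] orbit_refl[OF assms(3)] assms
    by (auto simp: orbits_def)
  then show ?thesis by (auto simp: orbit_def)
qed

lemma cls_act:
  assumes "S \<in> CHED" "g \<in> carrier (grp G S)" "y \<in> sec X S"
  shows "cls S (act X S g y) = cls S y"
  using cls_eq_iff[OF assms(1,3) act_in_sec[OF assms]] assms(2) by auto

lemma sec_quotient: "sec Y S = cls S ` sec X S"
  by (auto simp: gquotient_def orbits_def)

lemma res_quotient:
  assumes "S \<in> CHED" "T \<in> CHED" "f \<in> cmaps S T" "y \<in> sec X T"
  shows "res Y S T f (cls T y) = cls S (res X S T f y)"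
proof -
  have "cls S (res X S T f z) = cls S (res X S T f y)" if z: "z \<in> cls T y" for z
  proof -
    obtain g where g: "g \<in> carrier (grp G T)" "z = act X T g y"
      using z by (auto simp: orbit_def)
    then have "res X S T f z = act X S (gres G S T f g) (res X S T f y)"
      using res_act[OF assms(1-3) g(1) assms(4)] by simp
    then show ?thesis
      using cls_act[OF assms(1) gres_carrier[OF assms(1-3) g(1)]
          res_in_sec[OF X_presheaf assms]] by simp
  qed
  moreover have "y \<in> cls T y"
    using group_action.orbit_refl[OF is_action[OF assms(2)] assms(4)] .
  ultimately have "(\<Union>z\<in>cls T y. cls S (res X S T f z)) = cls S (res X S T f y)"
    by blast
  then show ?thesis by (simp add: gquotient_def)
qed

lemma quotient_presheaf: "ched_presheaf Y"
  unfolding ched_presheaf_def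
proof (intro conjI ballI)
  fix S T :: "'u topology" and f assume *: "S \<in> CHED" "T \<in> CHED" "f \<in> cmaps S T"
  then show "res Y S T f \<in> sec Y T \<rightarrow> sec Y S"
    using res_in_sec[OF X_presheaf *] by (auto simp: sec_quotient res_quotient)
next
  fix S :: "'u topology" and y assume "S \<in> CHED" "y \<in> sec Y S"
  then show "res Y S S (incl (topspace S)) y = y"
    by (auto simp: sec_quotient res_quotient id_in_cmaps res_id[OF X_presheaf])
next
  fix R S T :: "'u topology" and f g y
  assume *: "R \<in> CHED" "S \<in> CHED" "T \<in> CHED" "f \<in> cmaps R S" "g \<in> cmaps S T" "y \<in> sec Y T"
  then obtain x where x: "x \<in> sec X T" "y = cls T x" by (auto simp: sec_quotient)
  show "res Y R T (compose (topspace R) g f) y = res Y R S f (res Y S T g y)"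
    using res_res[OF X_presheaf *(1-5) x(1)] * x(1) unfolding x(2)
    by (simp add: res_quotient compose_in_cmaps[OF *(4,5)] res_in_sec[OF X_presheaf])
qed

text \<open>
  Orbits on the two pieces glue because representatives do.  The gluing is unique because the group
  elements that relate two representatives on the pieces glue as well; here the sheaf property
  of \<open>G\<close> is needed.
\<close>

lemma quotient_gluing:
  assumes S: "S \<in> CHED"
    and UV: "openin S U" "openin S V" "U \<inter> V = {}" "U \<union> V = topspace S"
  shows "bij_betw (\<lambda>y. (restr Y S U y, restr Y S V y))
    (sec Y S) (sec Y (subtopology S U) \<times> sec Y (subtopology S V))"
proof -
  note clU = clopenin_disjoint_pieces(1)[OF UV] and clV = clopenin_disjoint_pieces(2)[OF UV]
  let ?U = "subtopology S U" and ?V = "subtopology S V"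
  note CU = clopen_in_CHED[OF S clU] and CV = clopen_in_CHED[OF S clV]
  note IU = incl_in_cmaps[OF clU] and IV = incl_in_cmaps[OF clV]
  note resU = res_quotient[OF CU S IU] and resV = res_quotient[OF CV S IV]
  note XU = restr_in_sec[OF X_presheaf S clU] and XV = restr_in_sec[OF X_presheaf S clV]
  show ?thesis
  proof (rule bij_betw_imageI)
    show "inj_on (\<lambda>y. (restr Y S U y, restr Y S V y)) (sec Y S)"
    proof (rule inj_onI)
      fix a b assume "a \<in> sec Y S" "b \<in> sec Y S"
        and eq: "(restr Y S U a, restr Y S V a) = (restr Y S U b, restr Y S V b)"
      then obtain x y where x: "x \<in> sec X S" "a = cls S x" and y: "y \<in> sec X S" "b = cls S y"
        by (auto simp: sec_quotient)
      have "cls ?U (restr X S U x) = cls ?U (restr X S U y)"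
        "cls ?V (restr X S V x) = cls ?V (restr X S V y)"
        using eq resU resV x y by auto
      then obtain g h where g: "g \<in> carrier (grp G ?U)" "act X ?U g (restr X S U x) = restr X S U y"
        and h: "h \<in> carrier (grp G ?V)" "act X ?V h (restr X S V x) = restr X S V y"
        using cls_eq_iff[OF CU XU XU] cls_eq_iff[OF CV XV XV] x(1) y(1) by blast
      \<comment> \<open>The two translating elements glue to one that carries \<open>x\<close> to \<open>y\<close>.\<close>
      obtain k where k: "k \<in> carrier (grp G S)" "gres G ?U S (incl U) k = g"
        "gres G ?V S (incl V) k = h"
        using binary_gluing[OF G_condensed S UV, of g h] g(1) h(1) by auto
      have "restr X S U (act X S k x) = restr X S U y" "restr X S V (act X S k x) = restr X S V y"
        using res_act[OF CU S IU k(1) x(1)] res_act[OF CV S IV k(1) x(1)] k g h by auto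
      then have "act X S k x = y"
        using binary_gluing[OF X_condensed S UV XU[OF y(1)] XV[OF y(1)]]
          act_in_sec[OF S k(1) x(1)] y(1) by blast
      then show "a = b" using cls_eq_iff[OF S x(1) y(1)] k(1) x(2) y(2) by blast
    qed
    show "(\<lambda>y. (restr Y S U y, restr Y S V y)) ` sec Y S = sec Y ?U \<times> sec Y ?V"
    proof (intro subset_antisym subsetI)
      fix p assume "p \<in> sec Y ?U \<times> sec Y ?V"
      then obtain a b where ab: "a \<in> sec X ?U" "b \<in> sec X ?V" "p = (cls ?U a, cls ?V b)"
        by (auto simp: sec_quotient)
      obtain x where x: "x \<in> sec X S" "restr X S U x = a" "restr X S V x = b"
        using binary_gluing[OF X_condensed S UV ab(1,2)] by blast
      have "p = (restr Y S U (cls S x), restr Y S V (cls S x))"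
        using resU[OF x(1)] resV[OF x(1)] x(2,3) ab(3) by simp
      then show "p \<in> (\<lambda>y. (restr Y S U y, restr Y S V y)) ` sec Y S"
        using x(1) by (auto simp: sec_quotient)
    next
      fix p assume "p \<in> (\<lambda>y. (restr Y S U y, restr Y S V y)) ` sec Y S"
      then show "p \<in> sec Y ?U \<times> sec Y ?V"
        using restr_in_sec[OF quotient_presheaf S] clU clV by auto
    qed
  qed
qed

lemma quotient_condensed: "condensed_set Y"
proof -
  have "\<exists>z. sec X (discrete_topology {}) = {z}"
    using X_condensed unfolding condensed_set_def by (elim conjE)
  then have "\<exists>z. sec Y (discrete_topology {}) = {z}"
    unfolding sec_quotient by (metis image_empty image_insert)
  then show ?thesis
    unfolding condensed_set_def
    by (intro conjI ballI allI impI quotient_gluing quotient_presheaf; (elim conjE)?)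
qed


section \<open>Open actions\<close>

lemma sec_gorbit:
  "y \<in> sec (gorbit G X i) S \<longleftrightarrow> y \<in> sec X S \<and> cls S y = res Y S pt (to_pt S) i"
  by (simp add: gorbit_def)

text \<open>
  The first projection embeds the pullback into the condensed set of \<open>S\<close>, because the second
  component is the image of the first under \<open>\<eta>\<close>.  So representability is an equality of
  subobjects, and naturality is automatic.
\<close>

lemma pullback_representable_iff:
  assumes "S \<in> CHED" and \<eta>: "cset_map (underline S) X \<eta>"
  shows "cset_iso (cpullback (underline S) (gorbit G X i) \<eta> (\<lambda>_ y. y))
      (underline (subtopology S P)) (\<lambda>_. fst) \<longleftrightarrow>
    (\<forall>R\<in>CHED. \<forall>f\<in>cmaps R S. \<eta> R f \<in> sec (gorbit G X i) R \<longleftrightarrow> f ` topspace R \<subseteq> P)"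
    (is "cset_iso ?A ?B _ \<longleftrightarrow> ?R")
proof
  have secA: "sec ?A R = {(f, y). f \<in> cmaps R S \<and> y \<in> sec (gorbit G X i) R \<and> \<eta> R f = y}" for R
    by (simp add: cpullback_def underline_def)
  have secB: "sec ?B R = {f \<in> cmaps R S. f ` topspace R \<subseteq> P}" for R
    using cmaps_subtopology[of _ R S P] by (auto simp: underline_def)
  {
    assume iso: "cset_iso ?A ?B (\<lambda>_. fst)"
    show ?R
    proof (intro ballI)
      fix R :: "'u topology" and f assume R: "R \<in> CHED" and f: "f \<in> cmaps R S"
      have im: "fst ` sec ?A R = sec ?B R"
        using iso R by (auto simp: cset_iso_def bij_betw_def)
      have "f \<in> fst ` sec ?A R \<longleftrightarrow> \<eta> R f \<in> sec (gorbit G X i) R"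
        using f by (force simp: secA)
      moreover have "f \<in> sec ?B R \<longleftrightarrow> f ` topspace R \<subseteq> P"
        using f by (simp add: secB)
      ultimately show "\<eta> R f \<in> sec (gorbit G X i) R \<longleftrightarrow> f ` topspace R \<subseteq> P"
        by (simp only: im)
    qed
  }
  assume R: ?R
  have "bij_betw fst (sec ?A R) (sec ?B R)" if "R \<in> CHED" for R
  proof (rule bij_betw_imageI)
    show "inj_on fst (sec ?A R)" by (auto simp: secA inj_on_def)
    have "fst ` sec ?A R = {f \<in> cmaps R S. \<eta> R f \<in> sec (gorbit G X i) R}"
      unfolding secA by force
    also have "\<dots> = sec ?B R"
      unfolding secB using R that by blast
    finally show "fst ` sec ?A R = sec ?B R" .
  qed
  moreover from this have "cset_map ?A ?B (\<lambda>_. fst)"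
    by (auto simp: cset_map_def cpullback_def underline_def bij_betw_def)
  ultimately show "cset_iso ?A ?B (\<lambda>_. fst)" by (simp add: cset_iso_def)
qed

text \<open>
  Openness stated for sections instead of maps; the set \<open>P\<close> represents the functor of those maps
  into \<open>S\<close> along which \<open>y\<close> falls into the orbit of \<open>i\<close>.
\<close>

lemma open_action_iff:
  "open_action G X \<longleftrightarrow>
    (\<forall>S\<in>CHED. \<forall>y\<in>sec X S. \<forall>i\<in>sec Y pt. \<exists>P. openin S P \<and>
      (\<forall>R\<in>CHED. \<forall>f\<in>cmaps R S.
        res X R S f y \<in> sec (gorbit G X i) R \<longleftrightarrow> f ` topspace R \<subseteq> P))"  (is "_ \<longleftrightarrow> ?R")
proof
  assume O: "open_action G X"
  show ?R
  proof (intro ballI)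
    fix S :: "'u topology" and y i assume S: "S \<in> CHED" and y: "y \<in> sec X S" and i: "i \<in> sec Y pt"
    let ?\<eta> = "\<lambda>R f. res X R S f y"
    have \<eta>: "cset_map (underline S) X ?\<eta>"
      using S y X_presheaf by (auto simp: cset_map_def underline_def res_in_sec res_res)
    then obtain P where "openin S P" and "cset_iso (cpullback (underline S) (gorbit G X i) ?\<eta> (\<lambda>_ y. y))
        (underline (subtopology S P)) (\<lambda>_. fst)"
      using O S i unfolding open_action_def by blast
    then show "\<exists>P. openin S P \<and> (\<forall>R\<in>CHED. \<forall>f\<in>cmaps R S.
        res X R S f y \<in> sec (gorbit G X i) R \<longleftrightarrow> f ` topspace R \<subseteq> P)"
      unfolding pullback_representable_iff[OF S \<eta>] by blast
  qed
next
  assume R: ?R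
  show "open_action G X"
    unfolding open_action_def
  proof (intro ballI allI impI)
    fix S :: "'u topology" and \<eta> i
    assume S: "S \<in> CHED" and \<eta>: "cset_map (underline S) X \<eta>" and i: "i \<in> sec Y pt"
    have "\<eta> S (incl (topspace S)) \<in> sec X S"
      using S \<eta> id_in_cmaps[of S] by (auto simp: cset_map_def underline_def)
    then obtain P where "openin S P" "\<forall>R\<in>CHED. \<forall>f\<in>cmaps R S.
        \<eta> R f \<in> sec (gorbit G X i) R \<longleftrightarrow> f ` topspace R \<subseteq> P"
      using R S i cset_map_from_representable[OF \<eta> S] by metis
    then show "\<exists>P. openin S P \<and> cset_iso (cpullback (underline S) (gorbit G X i) \<eta> (\<lambda>_ y. y))
        (underline (subtopology S P)) (\<lambda>_. fst)"
      unfolding pullback_representable_iff[OF S \<eta>] by blast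
  qed
qed

text \<open>The label of a point is the orbit of the value of the section there, see \<open>label_eq\<close> below.\<close>

definition label :: "'u topology \<Rightarrow> 'x \<Rightarrow> 'u \<Rightarrow> 'x set" where
  "label S y = evaluation Y S (cls S y)"

lemma label_eq: "S \<in> CHED \<Longrightarrow> y \<in> sec X S \<Longrightarrow> s \<in> topspace S \<Longrightarrow>
    label S y s = cls pt (res X pt S (point s) y)"
  by (simp add: label_def evaluation_def res_quotient pt_in_CHED point_in_cmaps)

lemma cls_in_quotient: "y \<in> sec X S \<Longrightarrow> cls S y \<in> sec Y S"
  by (simp add: sec_quotient)

lemma label_in_quotient:
  "S \<in> CHED \<Longrightarrow> y \<in> sec X S \<Longrightarrow> s \<in> topspace S \<Longrightarrow> label S y s \<in> sec Y pt"
  by (simp add: label_eq cls_in_quotient res_in_sec[OF X_presheaf] pt_in_CHED point_in_cmaps)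

text \<open>
  Testing the representing set \<open>P i\<close> on points identifies it with the fibre of the label function
  over \<open>i\<close>; testing it on the inclusion of that fibre shows that \<open>y\<close> lies in the orbit of \<open>i\<close> there
  as a section.
\<close>

lemma quotient_discrete_if_open:
  assumes "open_action G X"
  shows "discrete_cset Y"
proof -
  have key: "label S y \<in> cmaps S (discrete_topology (sec Y pt)) \<and>
      (\<forall>i\<in>label S y ` topspace S.
        res X (fiber S (label S y) i) S (incl (topspace (fiber S (label S y) i))) y
          \<in> sec (gorbit G X i) (fiber S (label S y) i))"
    if S: "S \<in> CHED" and y: "y \<in> sec X S" for S y
  proof -
    have "\<forall>i\<in>sec Y pt. \<exists>P. openin S P \<and> (\<forall>R\<in>CHED. \<forall>f\<in>cmaps R S.
        res X R S f y \<in> sec (gorbit G X i) R \<longleftrightarrow> f ` topspace R \<subseteq> P)"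
      using assms[unfolded open_action_iff, rule_format, OF S y] by (intro ballI)
    from bchoice[OF this] obtain P where P': "\<forall>i\<in>sec Y pt. openin S (P i) \<and>
        (\<forall>R\<in>CHED. \<forall>f\<in>cmaps R S.
          res X R S f y \<in> sec (gorbit G X i) R \<longleftrightarrow> f ` topspace R \<subseteq> P i)"
      by (elim exE)
    have P: "openin S (P i)" if "i \<in> sec Y pt" for i
      using P' that by blast
    have mem: "res X R S f y \<in> sec (gorbit G X i) R \<longleftrightarrow> f ` topspace R \<subseteq> P i"
      if "i \<in> sec Y pt" "R \<in> CHED" "f \<in> cmaps R S" for i R f
      by (rule P'[THEN bspec, OF that(1), THEN conjunct2, rule_format, OF that(2,3)])
    \<comment> \<open>Over a point, lying in the orbit of \<open>i\<close> means having label \<open>i\<close>.\<close>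
    have lab: "label S y s = i \<longleftrightarrow> s \<in> P i" if s: "s \<in> topspace S" and i: "i \<in> sec Y pt" for s i
    proof -
      have "to_pt pt = incl (topspace (pt :: 'u topology))"
        by (auto simp: to_pt_def incl_def pt_def)
      then have "res Y pt pt (to_pt pt) i = i"
        using res_id[OF quotient_presheaf pt_in_CHED i] by simp
      then have "label S y s = i \<longleftrightarrow> res X pt S (point s) y \<in> sec (gorbit G X i) pt"
        using S y s by (simp add: label_eq sec_gorbit res_in_sec[OF X_presheaf] pt_in_CHED
            point_in_cmaps)
      also have "\<dots> \<longleftrightarrow> s \<in> P i"
        using mem[OF i pt_in_CHED point_in_cmaps[OF s]] by (auto simp: point_def pt_def)
      finally show ?thesis .
    qed
    have fib: "{s \<in> topspace S. label S y s = i} = P i" if "i \<in> sec Y pt" for i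
      using lab[OF _ that] openin_subset[OF P[OF that]] by auto
    have lc: "label S y \<in> cmaps S (discrete_topology (sec Y pt))"
      unfolding cmaps_discrete_iff using P fib label_in_quotient[OF S y]
      by (auto simp: label_def evaluation_def)
    moreover have "res X (fiber S (label S y) i) S (incl (topspace (fiber S (label S y) i))) y
        \<in> sec (gorbit G X i) (fiber S (label S y) i)" if "i \<in> label S y ` topspace S" for i
    proof -
      have i: "i \<in> sec Y pt" using that label_in_quotient[OF S y] by auto
      \<comment> \<open>The inclusion of the fibre factors through \<open>P i\<close>, which is the fibre itself.\<close>
      show ?thesis
        using mem[OF i fiber_in_CHED[OF S lc] incl_fiber_in_cmaps[OF lc], of i] fib[OF i]
        by (simp add: topspace_fiber incl_def)
    qed
    ultimately show ?thesis by blast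
  qed
  show ?thesis
  proof (rule discrete_csetI[OF quotient_condensed])
    fix S :: "'u topology" and c assume S: "S \<in> CHED" and "c \<in> sec Y S"
    then obtain y where y: "y \<in> sec X S" "c = cls S y" by (auto simp: sec_quotient)
    then have ev: "evaluation Y S c = label S y" by (simp add: label_def)
    show lc: "evaluation Y S c \<in> cmaps S (discrete_topology (sec Y pt))"
      using key[OF S y(1)] ev by simp
    fix i assume "i \<in> evaluation Y S c ` topspace S"
    then have "i \<in> label S y ` topspace S" by (simp only: ev)
    note mem = bspec[OF conjunct2[OF key[OF S y(1)]] this]
    show "res Y (fiber S (evaluation Y S c) i) S (incl (topspace (fiber S (evaluation Y S c) i))) c =
        res Y (fiber S (evaluation Y S c) i) pt (to_pt (fiber S (evaluation Y S c) i)) i"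
      using mem res_quotient[OF fiber_in_CHED[OF S lc] S incl_fiber_in_cmaps[OF lc] y(1), of i]
      unfolding ev topspace_fiber by (simp add: sec_gorbit y(2))
  qed
qed

lemma open_if_quotient_discrete:
  assumes D: "discrete_cset Y"
  shows "open_action G X"
  unfolding open_action_iff
proof (intro ballI exI conjI)
  fix S :: "'u topology" and y i assume S: "S \<in> CHED" and y: "y \<in> sec X S" and i: "i \<in> sec Y pt"
  let ?P = "{s \<in> topspace S. label S y s = i}"
  have "label S y \<in> cmaps S (discrete_topology (sec Y pt))"
    unfolding label_def by (rule discrete_csetD(1)[OF D S cls_in_quotient[OF y]])
  then show "openin S ?P" by (rule clopenin_fibre[unfolded clopenin_def, THEN conjunct1])
  fix R :: "'u topology" and f assume R: "R \<in> CHED" and f: "f \<in> cmaps R S"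
  have "res X R S f y \<in> sec (gorbit G X i) R \<longleftrightarrow>
      res Y R S f (cls S y) = res Y R pt (to_pt R) i"
    using R S f y by (simp add: sec_gorbit res_in_sec[OF X_presheaf] res_quotient)
  also have "\<dots> \<longleftrightarrow> (\<forall>r\<in>topspace R. evaluation Y R (res Y R S f (cls S y)) r = i)"
    by (rule discrete_eq_constant_iff[OF D quotient_presheaf R _ i])
      (rule res_in_sec[OF quotient_presheaf R S f cls_in_quotient[OF y]])
  also have "\<dots> \<longleftrightarrow> (\<forall>r\<in>topspace R. label S y (f r) = i)"
    by (simp add: evaluation_natural[OF quotient_presheaf R S f cls_in_quotient[OF y]]
        label_def compose_def)
  also have "\<dots> \<longleftrightarrow> f ` topspace R \<subseteq> ?P"
    using cmaps_mem[OF f] by auto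
  finally show "res X R S f y \<in> sec (gorbit G X i) R \<longleftrightarrow> f ` topspace R \<subseteq> ?P" .
qed


section \<open>The decomposition into orbits\<close>

text \<open>
  The isomorphism to the coproduct: a section of the coproduct consists of a locally constant function
  and one section of an orbit on each of its fibres.
\<close>

definition decomposition :: "'u topology \<Rightarrow> 'x \<Rightarrow> ('u \<Rightarrow> 'x set) \<times> ('x set \<Rightarrow> 'x)" where
  "decomposition S y =
     (label S y, \<lambda>i\<in>label S y ` topspace S.
        res X (fiber S (label S y) i) S (incl (topspace (fiber S (label S y) i))) y)"

abbreviation coproduct :: "('u, 'g, ('u \<Rightarrow> 'x set) \<times> ('x set \<Rightarrow> 'x)) gset" where
  "coproduct \<equiv> gcoproduct G (sec Y pt) (gorbit G X)"

lemma sec_coproduct: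
  "sec coproduct S = (SIGMA \<phi>:cmaps S (discrete_topology (sec Y pt)).
     \<Pi>\<^sub>E i\<in>\<phi> ` topspace S. sec (gorbit G X i) (fiber S \<phi> i))"
  by (simp add: gcoproduct_def Let_def)

lemma res_gorbit: "res (gorbit G X i) = res X"
  by (simp add: gorbit_def Let_def)

lemma act_gorbit: "y \<in> sec (gorbit G X i) S \<Longrightarrow> act (gorbit G X i) S g y = act X S g y"
  by (simp add: gorbit_def Let_def)

context
  assumes D: "discrete_cset Y"
begin

lemma label_in_cmaps:
  "S \<in> CHED \<Longrightarrow> y \<in> sec X S \<Longrightarrow> label S y \<in> cmaps S (discrete_topology (sec Y pt))"
  unfolding label_def by (rule discrete_csetD(1)[OF D _ cls_in_quotient])

text \<open>
  On a fibre of the label function all labels agree by definition; discreteness promotes this to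
  an equality of classes.
\<close>

lemma restriction_in_gorbit:
  assumes S: "S \<in> CHED" and y: "y \<in> sec X S" and i: "i \<in> label S y ` topspace S"
  defines "F \<equiv> fiber S (label S y) i"
  shows "res X F S (incl (topspace F)) y \<in> sec (gorbit G X i) F"
proof -
  have F: "F \<in> CHED" and inc: "incl (topspace F) \<in> cmaps F S"
    using label_in_cmaps[OF S y] S
    by (auto simp: F_def fiber_in_CHED incl_fiber_in_cmaps topspace_fiber)
  have i': "i \<in> sec Y pt" using i label_in_quotient[OF S y] by auto
  have "\<forall>s\<in>topspace F. evaluation Y F (res Y F S (incl (topspace F)) (cls S y)) s = i"
    unfolding evaluation_natural[OF quotient_presheaf F S inc cls_in_quotient[OF y]]
    by (auto simp: compose_def incl_def label_def[symmetric] F_def topspace_fiber)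
  then have "res Y F S (incl (topspace F)) (cls S y) = res Y F pt (to_pt F) i"
    using discrete_eq_constant_iff[OF D quotient_presheaf F _ i']
      res_in_sec[OF quotient_presheaf F S inc cls_in_quotient[OF y]] by blast
  then show ?thesis
    using res_in_sec[OF X_presheaf F S inc y] res_quotient[OF F S inc y] by (simp add: sec_gorbit)
qed

lemma decomposition_in_coproduct:
  "S \<in> CHED \<Longrightarrow> y \<in> sec X S \<Longrightarrow> decomposition S y \<in> sec coproduct S"
  by (auto simp: sec_coproduct decomposition_def label_in_cmaps restriction_in_gorbit)

text \<open>
  Gluing the components of a section of the coproduct inverts the construction.  The glued section has
  the prescribed label function because on each fibre its class is the prescribed constant.
\<close>

lemma decomposition_bij:
  assumes S: "S \<in> CHED"
  shows "bij_betw (decomposition S) (sec X S) (sec coproduct S)"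
proof (rule bij_betw_imageI)
  show "inj_on (decomposition S) (sec X S)"
  proof (rule inj_onI)
    fix y z assume y: "y \<in> sec X S" and z: "z \<in> sec X S"
      and eq: "decomposition S y = decomposition S z"
    let ?\<phi> = "label S y"
    have lab: "label S z = ?\<phi>" using eq by (simp add: decomposition_def)
    have "res X (fiber S ?\<phi> i) S (incl (topspace (fiber S ?\<phi> i))) z =
        res X (fiber S ?\<phi> i) S (incl (topspace (fiber S ?\<phi> i))) y"
      if "i \<in> ?\<phi> ` topspace S" for i
      using arg_cong[OF eq, of "\<lambda>p. snd p i"] that
      by (simp only: decomposition_def lab snd_conv restrict_apply')
    then show "y = z"
      by (intro fibre_separation[OF X_condensed S label_in_cmaps[OF S y] y z]) (rule sym)
  qed
  show "decomposition S ` sec X S = sec coproduct S"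
  proof (intro subset_antisym subsetI)
    fix p assume "p \<in> sec coproduct S"
    then obtain \<phi> \<xi> where p: "p = (\<phi>, \<xi>)" and \<phi>: "\<phi> \<in> cmaps S (discrete_topology (sec Y pt))"
      and \<xi>: "\<xi> \<in> (\<Pi>\<^sub>E i\<in>\<phi> ` topspace S. sec (gorbit G X i) (fiber S \<phi> i))"
      by (auto simp: sec_coproduct)
    have \<xi>i: "\<xi> i \<in> sec X (fiber S \<phi> i)"
        "cls (fiber S \<phi> i) (\<xi> i) = res Y (fiber S \<phi> i) pt (to_pt (fiber S \<phi> i)) i"
      if "i \<in> \<phi> ` topspace S" for i
      using PiE_mem[OF \<xi> that] by (auto simp: sec_gorbit)
    have "\<exists>!y. y \<in> sec X S \<and> (\<forall>i\<in>\<phi> ` topspace S.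
        res X (fiber S \<phi> i) S (incl (topspace (fiber S \<phi> i))) y = \<xi> i)"
      by (rule fibre_gluing[OF X_condensed S \<phi> \<xi>i(1)])
    from ex1_implies_ex[OF this] obtain y where y: "y \<in> sec X S" and res: "\<And>i. i \<in> \<phi> ` topspace S \<Longrightarrow>
        res X (fiber S \<phi> i) S (incl (topspace (fiber S \<phi> i))) y = \<xi> i"
      by (elim exE conjE) (rule that, assumption, erule bspec)
    have "label S y s = \<phi> s" if s: "s \<in> topspace S" for s
    proof -
      let ?F = "fiber S \<phi> (\<phi> s)"
      have "label S y s = evaluation Y ?F (res Y ?F S (incl (topspace ?F)) (cls S y)) s"
        unfolding label_def
        by (rule evaluation_restriction[OF quotient_presheaf S \<phi> cls_in_quotient[OF y] s])
      also have "res Y ?F S (incl (topspace ?F)) (cls S y) = cls ?F (\<xi> (\<phi> s))"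
        using res_quotient[OF fiber_in_CHED[OF S \<phi>] S incl_fiber_in_cmaps[OF \<phi>] y, of "\<phi> s"]
          res[of "\<phi> s"] s by (simp add: topspace_fiber)
      also have "\<dots> = res Y ?F pt (to_pt ?F) (\<phi> s)"
        using \<xi>i(2)[of "\<phi> s"] s by simp
      also have "evaluation Y ?F \<dots> s = \<phi> s"
        using s cmaps_mem[OF \<phi> s]
        by (simp add: evaluation_constant[OF quotient_presheaf fiber_in_CHED[OF S \<phi>]] topspace_fiber)
      finally show ?thesis .
    qed
    then have "label S y = \<phi>"
      using cmaps_extensional[OF \<phi>]
      by (auto simp: label_def evaluation_def extensional_def fun_eq_iff)
    moreover have "(\<lambda>i\<in>\<phi> ` topspace S. res X (fiber S \<phi> i) S (incl (topspace (fiber S \<phi> i))) y) = \<xi>"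
      using res PiE_arb[OF \<xi>] by (auto simp: restrict_def fun_eq_iff)
    ultimately have "decomposition S y = p" by (simp add: decomposition_def p)
    with y show "p \<in> decomposition S ` sec X S" by blast
  qed (use decomposition_in_coproduct[OF S] in auto)
qed

text \<open>
  The label functions match since evaluation is natural, and the components since both sides
  restrict \<open>y\<close> along the same composite from a fibre over \<open>S\<close> to \<open>T\<close>.
\<close>

lemma decomposition_natural:
  assumes S: "S \<in> CHED" and T: "T \<in> CHED" and f: "f \<in> cmaps S T" and y: "y \<in> sec X T"
  shows "decomposition S (res X S T f y) = res coproduct S T f (decomposition T y)"
proof -
  let ?\<phi> = "label T y"
  define \<psi> where "\<psi> = compose (topspace S) ?\<phi> f"
  have lab: "label S (res X S T f y) = \<psi>"
    unfolding \<psi>_def label_def using res_quotient[OF S T f y]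
      evaluation_natural[OF quotient_presheaf S T f cls_in_quotient[OF y]] by simp
  note \<phi> = label_in_cmaps[OF T y]
  have \<psi>: "\<psi> \<in> cmaps S (discrete_topology (sec Y pt))"
    unfolding \<psi>_def using f \<phi> by (rule compose_in_cmaps)
  have "res X (fiber S \<psi> i) S (incl (topspace (fiber S \<psi> i))) (res X S T f y) =
      res X (fiber S \<psi> i) (fiber T ?\<phi> i) (restrict f (topspace (fiber S \<psi> i)))
        (res X (fiber T ?\<phi> i) T (incl (topspace (fiber T ?\<phi> i))) y)" for i
  proof -
    let ?A = "fiber S \<psi> i" and ?B = "fiber T ?\<phi> i"
    have A: "?A \<in> CHED" and B: "?B \<in> CHED"
      by (rule fiber_in_CHED[OF S \<psi>] fiber_in_CHED[OF T \<phi>])+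
    have iA: "incl (topspace ?A) \<in> cmaps ?A S" and iB: "incl (topspace ?B) \<in> cmaps ?B T"
      unfolding topspace_fiber by (rule incl_fiber_in_cmaps[OF \<psi>] incl_fiber_in_cmaps[OF \<phi>])+
    have fAB: "restrict f (topspace ?A) \<in> cmaps ?A ?B"
    proof -
      have "continuous_map ?A T f"
        using f by (auto simp: fiber_def cmaps_def intro: continuous_map_from_subtopology)
      then have "continuous_map ?A T (restrict f (topspace ?A))"
        by (rule continuous_map_eq) auto
      moreover have "restrict f (topspace ?A) ` topspace ?A \<subseteq> {t \<in> topspace T. ?\<phi> t = i}"
        using cmaps_mem[OF f] by (auto simp: topspace_fiber \<psi>_def compose_def)
      ultimately show ?thesis
        by (auto simp: cmaps_def fiber_def[of T] continuous_map_in_subtopology)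
    qed
    have "compose (topspace ?A) f (incl (topspace ?A)) =
        compose (topspace ?A) (incl (topspace ?B)) (restrict f (topspace ?A))"
      using cmaps_mem[OF fAB] by (auto simp: compose_def incl_def fun_eq_iff)
    then show ?thesis
      by (simp add: res_res[OF X_presheaf A S T iA f y] res_res[OF X_presheaf A B T fAB iB y])
  qed
  moreover have "i \<in> ?\<phi> ` topspace T" if "i \<in> \<psi> ` topspace S" for i
    using that cmaps_mem[OF f] by (auto simp: \<psi>_def compose_def)
  ultimately show ?thesis
    unfolding decomposition_def lab
    by (auto simp: gcoproduct_def Let_def res_gorbit \<psi>_def[symmetric] intro!: restrict_ext)
qed

lemma decomposition_equivariant:
  assumes S: "S \<in> CHED" and g: "g \<in> carrier (grp G S)" and y: "y \<in> sec X S"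
  shows "decomposition S (act X S g y) = act coproduct S g (decomposition S y)"
proof -
  let ?\<phi> = "label S y"
  have lab: "label S (act X S g y) = ?\<phi>"
    by (simp add: label_def cls_act[OF S g y])
  have "res X (fiber S ?\<phi> i) S (incl (topspace (fiber S ?\<phi> i))) (act X S g y) =
      act (gorbit G X i) (fiber S ?\<phi> i) (gres G (fiber S ?\<phi> i) S (incl (topspace (fiber S ?\<phi> i))) g)
        (res X (fiber S ?\<phi> i) S (incl (topspace (fiber S ?\<phi> i))) y)"
    if i: "i \<in> ?\<phi> ` topspace S" for i
    unfolding act_gorbit[OF restriction_in_gorbit[OF S y i]] unfolding topspace_fiber
    by (rule res_act[OF fiber_in_CHED[OF S label_in_cmaps[OF S y]] S
        incl_fiber_in_cmaps[OF label_in_cmaps[OF S y]] g y])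
  moreover have "act coproduct S g (decomposition S y) =
      (?\<phi>, \<lambda>i\<in>?\<phi> ` topspace S. act (gorbit G X i) (fiber S ?\<phi> i)
        (gres G (fiber S ?\<phi> i) S (incl (topspace (fiber S ?\<phi> i))) g) (snd (decomposition S y) i))"
    using decomposition_in_coproduct[OF S y]
    by (simp add: gcoproduct_def Let_def decomposition_def)
  ultimately show ?thesis
    by (auto simp: decomposition_def lab intro!: restrict_ext)
qed

lemma decomposition_iso: "gset_iso G X coproduct decomposition"
  using decomposition_bij decomposition_natural decomposition_equivariant decomposition_in_coproduct
  by (simp add: gset_iso_def cset_iso_def cset_map_def)

end

text \<open>
  A section of the orbit of \<open>i\<close> has constant label \<open>i\<close>, so its only fibre is the whole space, or
  there is none if the space is empty; the default values of the two sides agree in both cases.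
\<close>

lemma decomposition_on_orbit:
  assumes i: "i \<in> sec Y pt" and S: "S \<in> CHED" and y: "y \<in> sec (gorbit G X i) S"
  shows "decomposition S y = coprojection i S y"
proof -
  have lab: "label S y = (\<lambda>_\<in>topspace S. i)"
    using y evaluation_constant[OF quotient_presheaf S i] by (simp add: label_def sec_gorbit)
  have "{s \<in> topspace S. label S y s = i} = topspace S"
    using lab by auto
  then have "fiber S (label S y) i = S"
    by (simp add: fiber_def)
  moreover have "res X S S (incl (topspace S)) y = y"
    using y res_id[OF X_presheaf S] by (simp add: sec_gorbit)
  moreover have "j = i" if "j \<in> label S y ` topspace S" for j
    using that lab by auto
  ultimately have "(\<lambda>j\<in>label S y ` topspace S. res X (fiber S (label S y) j) S
      (incl (topspace (fiber S (label S y) j))) y) = (\<lambda>_\<in>label S y ` topspace S. y)"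
    by (intro restrict_ext) metis
  then show ?thesis
    by (simp add: decomposition_def coprojection_def Let_def lab)
qed

end


theorem proposition4p5:
  fixes G :: "('u, 'g) cgroup" and X :: "('u, 'g, 'x) gset"
  assumes "condensed_group G" and "G_set G X"
  shows "(open_action G X \<longleftrightarrow> discrete_cset (gquotient G X)) \<and>
    (open_action G X \<longrightarrow>
      (\<exists>\<Phi>. gset_iso G X (gcoproduct G (sec (gquotient G X) pt) (gorbit G X)) \<Phi> \<and>
           (\<forall>x\<in>sec (gquotient G X) pt. \<forall>S\<in>CHED. \<forall>y\<in>sec (gorbit G X x) S.
              \<Phi> S y = coprojection x S y)))"
proof -
  interpret condensed_action G X using assms by unfold_locales
  show ?thesis
    using quotient_discrete_if_open open_if_quotient_discrete decomposition_iso decomposition_on_orbit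
    by blast
qed

end
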